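(* Let $A$ and $B$ be C$^*$-algebras and let $\Delta : A\to B$ be a 2-local $^*$-homomorphism, that is, a map (not assumed linear nor continuous) such that for every $a,b\in A$ there exists a $^*$-homomorphism $\pi_{a,b}: A\to B$ (depending on $a$ and $b$) satisfying $\Delta(a) = \pi_{a,b}(a)$ and $\Delta(b) = \pi_{a,b}(b)$. Then $\Delta$ is a linear $^*$-homomorphism.
   Context: A $^*$-homomorphism between C$^*$-algebras is a linear, multiplicative map $\pi$ with $\pi(x^* )=\pi(x)^*$ for all $x$. C$^*$-algebras are not assumed unital, and $^*$-homomorphisms are not assumed unital. *)

theory Defs
  imports Complex_Main
begin

text \<open>
  HOL has only real vector spaces. Complex scalars are added on top of the real ones:
  \<open>scaleR_scaleC\<close> makes the real scalar multiplication the restriction of the complex one,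
  so norm, topology and completeness are those of the library classes.
\<close>

class complex_vector = real_vector +
  fixes scaleC :: "complex \<Rightarrow> 'a \<Rightarrow> 'a"  (infixr "*\<^sub>C" 75)
  assumes scaleC_add_right: "c *\<^sub>C (x + y) = c *\<^sub>C x + c *\<^sub>C y"
    and scaleC_add_left: "(c + d) *\<^sub>C x = c *\<^sub>C x + d *\<^sub>C x"
    and scaleC_scaleC: "c *\<^sub>C d *\<^sub>C x = (c * d) *\<^sub>C x"
    and scaleC_one: "1 *\<^sub>C x = x"
    and scaleR_scaleC: "r *\<^sub>R x = complex_of_real r *\<^sub>C x"

class complex_normed_vector = complex_vector + real_normed_vector +
  assumes norm_scaleC: "norm (c *\<^sub>C x) = cmod c * norm x"

text \<open>Not assumed unital: \<open>real_normed_algebra\<close> is the library's class without a unit.\<close>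

class complex_normed_algebra = complex_normed_vector + real_normed_algebra +
  assumes mult_scaleC_left: "(c *\<^sub>C x) * y = c *\<^sub>C (x * y)"
    and mult_scaleC_right: "x * (c *\<^sub>C y) = c *\<^sub>C (x * y)"

class cstar_algebra = complex_normed_algebra + banach +
  fixes star :: "'a \<Rightarrow> 'a"
  assumes star_star: "star (star x) = x"
    and star_add: "star (x + y) = star x + star y"
    and star_scaleC: "star (c *\<^sub>C x) = cnj c *\<^sub>C star x"
    and star_mult: "star (x * y) = star y * star x"
    and norm_star_mult_self: "norm (star x * x) = (norm x)\<^sup>2"

definition clinear :: "('a::complex_vector \<Rightarrow> 'b::complex_vector) \<Rightarrow> bool"
  where "clinear f \<longleftrightarrow>
    (\<forall>x y. f (x + y) = f x + f y) \<and> (\<forall>c x. f (c *\<^sub>C x) = c *\<^sub>C f x)"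

definition star_homomorphism :: "('a::cstar_algebra \<Rightarrow> 'b::cstar_algebra) \<Rightarrow> bool"
  where "star_homomorphism \<pi> \<longleftrightarrow>
    clinear \<pi> \<and> (\<forall>x y. \<pi> (x * y) = \<pi> x * \<pi> y) \<and> (\<forall>x. \<pi> (star x) = star (\<pi> x))"

definition two_local_star_homomorphism :: "('a::cstar_algebra \<Rightarrow> 'b::cstar_algebra) \<Rightarrow> bool"
  where "two_local_star_homomorphism \<Delta> \<longleftrightarrow>
    (\<forall>a b. \<exists>\<pi>. star_homomorphism \<pi> \<and> \<Delta> a = \<pi> a \<and> \<Delta> b = \<pi> b)"

end

theory Submission
  imports Defs
begin

text \<open>
  Any two self-adjoint elements \<open>a\<close> and \<open>b\<close> are the real and imaginary parts of the single element
  \<open>x = a + \<i>b\<close>. Both \<open>a + b\<close> and \<open>a * b\<close> are polynomials in \<open>x\<close> and \<open>star x\<close>, so locality at a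
  pair \<open>(x, p)\<close>, with \<open>p\<close> such a polynomial, already shows that \<open>\<Delta>\<close> is additive and multiplicative
  on self-adjoint elements. The general case follows from \<open>\<Delta> x = \<Delta> a + \<i> \<Delta> b\<close> and homogeneity.
\<close>

lemma scaleC_minus1: "(- 1) *\<^sub>C x = - (x :: 'a::complex_vector)"
  using scaleR_scaleC[of "- 1" x] by simp

lemma scaleC_half_double: "(1/2) *\<^sub>C (x + x) = (x :: 'a::complex_vector)"
  using scaleC_add_left[of "1/2" "1/2" x] by (simp add: scaleC_add_right scaleC_one)

definition real_part :: "'a::cstar_algebra \<Rightarrow> 'a"
  where "real_part x = (1/2) *\<^sub>C (x + star x)"

text \<open>The difference is written with the scalar -1, so that the two clauses of
  \<open>clinear\<close> suffice to carry a homomorphism through it.\<close>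

definition imag_part :: "'a::cstar_algebra \<Rightarrow> 'a"
  where "imag_part x = (- \<i>/2) *\<^sub>C (x + (- 1) *\<^sub>C star x)"

lemma real_part_plus_imag_part: "real_part x + \<i> *\<^sub>C imag_part x = x"
proof -
  have "real_part x + \<i> *\<^sub>C imag_part x = (1/2) *\<^sub>C ((x + star x) + (x + - star x))"
    by (simp only: real_part_def imag_part_def scaleC_scaleC scaleC_minus1 scaleC_add_right) simp
  then show ?thesis
    using scaleC_half_double[of x] by simp
qed

lemma star_real_part: "star (real_part x) = real_part x"
  by (simp add: real_part_def star_scaleC star_add star_star add.commute)

lemma star_imag_part: "star (imag_part x) = imag_part x"
  by (simp add: imag_part_def star_scaleC star_add star_star scaleC_add_right scaleC_scaleC add.commute)

text \<open>Together with \<open>imag_part_cartesian\<close> this is uniqueness of the Cartesian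
  decomposition: an arbitrary self-adjoint pair is recovered from one element.\<close>

lemma real_part_cartesian:
  assumes "star a = a" "star b = b"
  shows "real_part (a + \<i> *\<^sub>C b) = a"
proof -
  have minus: "(- \<i>) *\<^sub>C b = - (\<i> *\<^sub>C b)"
    using scaleC_scaleC[of "- 1" \<i> b] by (simp add: scaleC_minus1)
  have "real_part (a + \<i> *\<^sub>C b) = (1/2) *\<^sub>C ((a + \<i> *\<^sub>C b) + (a + - (\<i> *\<^sub>C b)))"
    by (simp add: real_part_def star_add star_scaleC assms minus)
  also have "(a + \<i> *\<^sub>C b) + (a + - (\<i> *\<^sub>C b)) = a + a"
    by simp
  finally show ?thesis
    by (simp only: scaleC_half_double)
qed

lemma imag_part_cartesian:
  assumes "star a = a" "star b = b"
  shows "imag_part (a + \<i> *\<^sub>C b) = b"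
proof -
  \<comment> \<open>Cancel the real part, already known to be \<open>a\<close>, from the
    decomposition of \<open>a + \<i> *\<^sub>C b\<close>.\<close>
  have "\<i> *\<^sub>C imag_part (a + \<i> *\<^sub>C b) = \<i> *\<^sub>C b"
    using real_part_plus_imag_part[of "a + \<i> *\<^sub>C b"] real_part_cartesian[OF assms] by simp
  then have "(- \<i>) *\<^sub>C \<i> *\<^sub>C imag_part (a + \<i> *\<^sub>C b) = (- \<i>) *\<^sub>C \<i> *\<^sub>C b"
    by simp
  then show ?thesis
    by (simp add: scaleC_scaleC scaleC_one)
qed

lemma star_homomorphism_simps:
  assumes "star_homomorphism \<pi>"
  shows "\<pi> (x + y) = \<pi> x + \<pi> y" "\<pi> (c *\<^sub>C x) = c *\<^sub>C \<pi> x"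
    "\<pi> (x * y) = \<pi> x * \<pi> y" "\<pi> (star x) = star (\<pi> x)"
    "\<pi> (real_part x) = real_part (\<pi> x)" "\<pi> (imag_part x) = imag_part (\<pi> x)"
  using assms
  by (simp_all add: star_homomorphism_def clinear_def real_part_def imag_part_def)

context
  fixes \<Delta> :: "'a::cstar_algebra \<Rightarrow> 'b::cstar_algebra"
  assumes two_local: "two_local_star_homomorphism \<Delta>"
begin

lemma two_localE:
  obtains \<pi> where "star_homomorphism \<pi>" "\<Delta> x = \<pi> x" "\<Delta> y = \<pi> y"
  using two_local unfolding two_local_star_homomorphism_def by blast

text \<open>Here and in the next three lemmas the second point is an expression in \<open>x\<close>
  alone, so the homomorphism chosen for the two points transfers the identity.\<close>

lemma two_local_scaleC: "\<Delta> (c *\<^sub>C x) = c *\<^sub>C \<Delta> x"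
  by (rule two_localE[of x "c *\<^sub>C x"]) (simp add: star_homomorphism_simps)

lemma two_local_star: "\<Delta> (star x) = star (\<Delta> x)"
  by (rule two_localE[of x "star x"]) (simp add: star_homomorphism_simps)

lemma two_local_real_part: "\<Delta> (real_part x) = real_part (\<Delta> x)"
  by (rule two_localE[of x "real_part x"]) (simp add: star_homomorphism_simps)

lemma two_local_imag_part: "\<Delta> (imag_part x) = imag_part (\<Delta> x)"
  by (rule two_localE[of x "imag_part x"]) (simp add: star_homomorphism_simps)

text \<open>Additivity of \<open>\<Delta>\<close> is not yet available; instead the element
  \<open>\<Delta> x\<close> itself is decomposed in the target algebra.\<close>

lemma two_local_cartesian: "\<Delta> x = \<Delta> (real_part x) + \<i> *\<^sub>C \<Delta> (imag_part x)"
  by (simp add: two_local_real_part two_local_imag_part real_part_plus_imag_part)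

lemma two_local_add_selfadjoint:
  assumes "star a = a" "star b = b"
  shows "\<Delta> (a + b) = \<Delta> a + \<Delta> b"
proof -
  \<comment> \<open>The homomorphism need agree with \<open>\<Delta>\<close> only at
    \<open>x\<close> and at the sum: the values of \<open>\<Delta>\<close> at the two parts are
    already determined by \<open>\<Delta> x\<close>.\<close>
  have "\<Delta> (real_part x + imag_part x) = \<Delta> (real_part x) + \<Delta> (imag_part x)" for x
    by (rule two_localE[of x "real_part x + imag_part x"])
      (simp add: star_homomorphism_simps two_local_real_part two_local_imag_part)
  from this[of "a + \<i> *\<^sub>C b"] show ?thesis
    by (simp add: real_part_cartesian imag_part_cartesian assms)
qed

lemma two_local_mult_selfadjoint:
  assumes "star a = a" "star b = b"
  shows "\<Delta> (a * b) = \<Delta> a * \<Delta> b"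
proof -
  have "\<Delta> (real_part x * imag_part x) = \<Delta> (real_part x) * \<Delta> (imag_part x)" for x
    by (rule two_localE[of x "real_part x * imag_part x"])
      (simp add: star_homomorphism_simps two_local_real_part two_local_imag_part)
  from this[of "a + \<i> *\<^sub>C b"] show ?thesis
    by (simp add: real_part_cartesian imag_part_cartesian assms)
qed

lemma two_local_add: "\<Delta> (x + y) = \<Delta> x + \<Delta> y"
proof -
  have re: "real_part (x + y) = real_part x + real_part y"
    by (simp add: real_part_def star_add scaleC_add_right algebra_simps)
  have im: "imag_part (x + y) = imag_part x + imag_part y"
    by (simp add: imag_part_def star_add scaleC_add_right algebra_simps)
  have "\<Delta> (x + y) = \<Delta> (real_part x + real_part y) + \<i> *\<^sub>C \<Delta> (imag_part x + imag_part y)"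
    by (simp add: two_local_cartesian[of "x + y"] re im)
  also have "\<dots> = (\<Delta> (real_part x) + \<i> *\<^sub>C \<Delta> (imag_part x))
      + (\<Delta> (real_part y) + \<i> *\<^sub>C \<Delta> (imag_part y))"
    by (simp add: two_local_add_selfadjoint star_real_part star_imag_part scaleC_add_right algebra_simps)
  finally show ?thesis
    by (simp flip: two_local_cartesian)
qed

text \<open>A product of self-adjoint elements need not be self-adjoint, so splitting the expanded
  product into its four terms takes the general \<open>two_local_add\<close>.\<close>

lemma two_local_mult: "\<Delta> (x * y) = \<Delta> x * \<Delta> y"
proof -
  have "\<Delta> (x * y) = \<Delta> ((real_part x + \<i> *\<^sub>C imag_part x) * (real_part y + \<i> *\<^sub>C imag_part y))"
    by (simp add: real_part_plus_imag_part)
  also have "\<dots> = (\<Delta> (real_part x) + \<i> *\<^sub>C \<Delta> (imag_part x))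
      * (\<Delta> (real_part y) + \<i> *\<^sub>C \<Delta> (imag_part y))"
    by (simp add: distrib_left distrib_right mult_scaleC_left mult_scaleC_right two_local_add
        two_local_scaleC two_local_mult_selfadjoint star_real_part star_imag_part)
  finally show ?thesis
    by (simp flip: two_local_cartesian)
qed

end

theorem corollary2p8:
  fixes \<Delta> :: "'a::cstar_algebra \<Rightarrow> 'b::cstar_algebra"
  assumes "two_local_star_homomorphism \<Delta>"
  shows "star_homomorphism \<Delta>"
  unfolding star_homomorphism_def clinear_def
  using two_local_add[OF assms] two_local_scaleC[OF assms] two_local_mult[OF assms]
    two_local_star[OF assms]
  by blast

end
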